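(* Let $k$ be a positive integer. There exists an integer $d_0$ (which may depend on $k$) such that for every integer $d\geq d_0$, there exist two disjoint lattice $(d,k)$-polytopes $P$ and $Q$ such that $$d(P,Q)\leq\frac{1}{\bigl(k\sqrt{d}\bigr)^{\sqrt{d}}}.$$
   Context: A polytope in $\mathbb{R}^d$ is the convex hull of a non-empty finite set of points. A lattice polytope is a polytope all of whose vertices belong to $\mathbb{Z}^d$. A lattice $(d,k)$-polytope is a lattice polytope (of any dimension) contained in the hypercube $[0,k]^d$. $d(P,Q)$ denotes the minimal Euclidean distance between a point of $P$ and a point of $Q$ (the letter $d$ alone denotes the dimension of the ambient space). *)

theory Defs
  imports "HOL-Analysis.Analysis" "HOL-Analysis.Finite_Function_Topology"
begin

text \<open>
  The dimension \<open>d\<close> is quantified inside the theorem, so \<open>\<real>\<^sup>d\<close> cannot be the type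
  \<open>real ^ 'n\<close>. It is rendered as the subspace of finitely supported real sequences that vanish
  at all indices \<open>\<ge> d\<close>, with coordinates \<open>0, \<dots>, d - 1\<close>. The library makes the ambient type a
  \<open>real_vector\<close>, so that \<open>polytope\<close> and \<open>extreme_point_of\<close> apply.
\<close>

type_synonym rseq = "nat \<Rightarrow>\<^sub>0 real"

definition coord_space :: "nat \<Rightarrow> rseq set" where
  "coord_space d = {x. \<forall>i\<ge>d. Poly_Mapping.lookup x i = 0}"

definition integer_points :: "nat \<Rightarrow> rseq set" where
  "integer_points d = {x \<in> coord_space d. \<forall>i<d. Poly_Mapping.lookup x i \<in> \<int>}"

definition hypercube :: "nat \<Rightarrow> nat \<Rightarrow> rseq set" where
  "hypercube d k = {x \<in> coord_space d. \<forall>i<d. Poly_Mapping.lookup x i \<in> {0..real k}}"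

text \<open>The library's \<open>polytope\<close> admits the empty set, which is excluded here.\<close>

definition lattice_polytope :: "nat \<Rightarrow> rseq set \<Rightarrow> bool" where
  "lattice_polytope d P \<longleftrightarrow>
     polytope P \<and> P \<noteq> {} \<and> P \<subseteq> coord_space d \<and> {v. v extreme_point_of P} \<subseteq> integer_points d"

definition lattice_dk_polytope :: "nat \<Rightarrow> nat \<Rightarrow> rseq set \<Rightarrow> bool" where
  "lattice_dk_polytope d k P \<longleftrightarrow> lattice_polytope d P \<and> P \<subseteq> hypercube d k"

text \<open>
  The library's \<open>dist\<close> (hence also \<open>setdist\<close>) on finitely supported functions is the
  \<open>\<ell>\<^sub>1\<close> distance, so the Euclidean distance is defined separately.
\<close>

definition euclid_dist :: "nat \<Rightarrow> rseq \<Rightarrow> rseq \<Rightarrow> real" where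
  "euclid_dist d x y = L2_set (\<lambda>i. Poly_Mapping.lookup x i - Poly_Mapping.lookup y i) {..<d}"

definition euclid_setdist :: "nat \<Rightarrow> rseq set \<Rightarrow> rseq set \<Rightarrow> real" where
  "euclid_setdist d P Q = Inf {euclid_dist d x y | x y. x \<in> P \<and> y \<in> Q}"

text \<open>For polytopes the infimum is a minimum.\<close>

lemma dist_lookup_le:
  fixes x y :: rseq
  shows "dist (Poly_Mapping.lookup x i) (Poly_Mapping.lookup y i) \<le> dist x y"
proof (cases "i \<in> Poly_Mapping.keys x \<union> Poly_Mapping.keys y")
  case True
  then show ?thesis
    unfolding dist_poly_mapping_def by (intro member_le_sum) auto
next
  case False
  then show ?thesis by (simp add: in_keys_iff)
qed

lemma continuous_on_lookup:
  "continuous_on UNIV (\<lambda>x :: rseq. Poly_Mapping.lookup x i)"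
  unfolding continuous_on_iff
proof (intro ballI allI impI)
  fix x :: rseq and e :: real
  assume "0 < e"
  then show "\<exists>\<delta>>0. \<forall>y\<in>UNIV. dist y x < \<delta> \<longrightarrow>
      dist (Poly_Mapping.lookup y i) (Poly_Mapping.lookup x i) < e"
    by (intro exI [of _ e] conjI ballI impI le_less_trans [OF dist_lookup_le]) assumption+
qed

lemma euclid_setdist_attained:
  assumes "polytope P" "P \<noteq> {}" "polytope Q" "Q \<noteq> {}"
  obtains p q where "p \<in> P" "q \<in> Q" "euclid_setdist d P Q = euclid_dist d p q"
    "\<And>x y. x \<in> P \<Longrightarrow> y \<in> Q \<Longrightarrow> euclid_dist d p q \<le> euclid_dist d x y"
proof -
  have "compact (P \<times> Q)"
    using assms by (metis polytope_def compact_Times finite_imp_compact_convex_hull)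
  moreover have "P \<times> Q \<noteq> {}" using assms by auto
  moreover have "continuous_on (P \<times> Q) (\<lambda>z. euclid_dist d (fst z) (snd z))"
  proof -
    have "continuous_on (P \<times> Q) (\<lambda>z. Poly_Mapping.lookup (fst z) i)"
         "continuous_on (P \<times> Q) (\<lambda>z. Poly_Mapping.lookup (snd z) i)" for i
      by (rule continuous_on_compose2 [OF continuous_on_lookup], rule continuous_on_fst continuous_on_snd,
          rule continuous_on_id, rule subset_UNIV)+
    then show ?thesis
      unfolding euclid_dist_def L2_set_def
      by (intro continuous_on_real_sqrt continuous_on_sum continuous_on_power continuous_on_diff)
  qed
  ultimately have "\<exists>z \<in> P \<times> Q. \<forall>w \<in> P \<times> Q.
      euclid_dist d (fst z) (snd z) \<le> euclid_dist d (fst w) (snd w)"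
    by (rule continuous_attains_inf)
  then obtain z where z: "z \<in> P \<times> Q"
    "\<And>w. w \<in> P \<times> Q \<Longrightarrow> euclid_dist d (fst z) (snd z) \<le> euclid_dist d (fst w) (snd w)"
    by blast
  obtain p q where pq: "z = (p, q)" by (cases z)
  have p: "p \<in> P" and q: "q \<in> Q" using z pq by auto
  have le: "euclid_dist d p q \<le> euclid_dist d x y" if "x \<in> P" "y \<in> Q" for x y
    using z(2) [of "(x, y)"] that pq by simp
  have "euclid_setdist d P Q = euclid_dist d p q"
    unfolding euclid_setdist_def by (rule cInf_eq_minimum) (use p q le in auto)
  then show thesis using that p q le by blast
qed

end

theory Submission
  imports Defs "HOL-Real_Asymp.Real_Asymp"
begin

text \<open>
  The vertices \<open>v\<^sub>i = e\<^sub>i + e\<^bsub>n+i\<^esub>\<close> of \<open>P\<close> and \<open>w\<^sub>i = e\<^bsub>n+i\<^esub> + \<Sum>\<^bsub>i<j<n\<^esub> e\<^sub>j\<close>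
  of \<open>Q\<close>, for \<open>i < n = d div 2\<close>, are 0/1 vectors. A point of \<open>P\<close> with coefficients \<open>\<lambda>\<close> agrees with
  a point of \<open>Q\<close> with coefficients \<open>\<mu>\<close> iff \<open>\<lambda>\<^sub>j = \<mu>\<^sub>j\<close> and \<open>\<lambda>\<^sub>j = \<Sum>\<^bsub>i<j\<^esub> \<mu>\<^sub>i\<close> for all \<open>j < n\<close>. These
  equations force all coefficients to vanish, so \<open>P\<close> and \<open>Q\<close> are disjoint. The coefficients
  proportional to \<open>1, 1, 2, 4, \<dots>, 2\<^bsup>n-2\<^esup>\<close> violate only the equation \<open>\<lambda>\<^sub>0 = 0\<close>, and by \<open>2\<^bsup>1-n\<^esup>\<close>.
  As \<open>n\<close> is about \<open>d/2\<close>, this is eventually below the claimed bound for every fixed \<open>k\<close>.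
\<close>

definition P_vertex :: "nat \<Rightarrow> nat \<Rightarrow> rseq" where
  "P_vertex n i = Poly_Mapping.single i 1 + Poly_Mapping.single (n + i) 1"

definition Q_vertex :: "nat \<Rightarrow> nat \<Rightarrow> rseq" where
  "Q_vertex n i = Poly_Mapping.single (n + i) 1 + (\<Sum>j\<in>{i<..<n}. Poly_Mapping.single j 1)"

lemma lookup_P_vertex:
  "i < n \<Longrightarrow> Poly_Mapping.lookup (P_vertex n i) j = of_bool (j = i \<or> j = n + i)"
  by (auto simp: P_vertex_def lookup_add lookup_single when_def)

lemma lookup_Q_vertex:
  "i < n \<Longrightarrow> Poly_Mapping.lookup (Q_vertex n i) j = of_bool (j = n + i \<or> i < j \<and> j < n)"
  by (auto simp: Q_vertex_def lookup_add lookup_sum lookup_single when_def)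

lemma lookup_scaleR:
  fixes x :: "'a \<Rightarrow>\<^sub>0 'b::real_vector"
  shows "Poly_Mapping.lookup (r *\<^sub>R x) i = r *\<^sub>R Poly_Mapping.lookup x i"
proof -
  have "finite {i. r *\<^sub>R Poly_Mapping.lookup x i \<noteq> 0}"
    by (rule finite_subset[OF _ finite_lookup[of x]]) auto
  then show ?thesis
    by (simp add: scaleR_poly_mapping_def)
qed

lemma linear_lookup: "linear (\<lambda>x :: rseq. Poly_Mapping.lookup x i)"
  by (rule linearI) (simp_all add: lookup_add lookup_scaleR)

lemma convex_linear_eq:
  fixes f :: "'a::real_vector \<Rightarrow> real"
  assumes "linear f"
  shows "convex {x. f x = c}"
  using convex_linear_vimage[OF assms convex_singleton[of c]] by (simp add: vimage_def)

lemma convex_hypercube: "convex (hypercube d k)"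
proof -
  have "hypercube d k = (\<Inter>i\<in>{d..}. {x. Poly_Mapping.lookup x i = 0}) \<inter>
      (\<Inter>i\<in>{..<d}. (\<lambda>x. Poly_Mapping.lookup x i) -` {0..real k})"
    by (auto simp: hypercube_def coord_space_def)
  also have "convex \<dots>"
    by (intro convex_Int convex_INT convex_linear_eq convex_linear_vimage linear_lookup convex_real_interval)
  finally show ?thesis .
qed

text \<open>Extreme points of a convex hull lie in the generating set, and the hypercube is convex,
  so it suffices to check the generators.\<close>

lemma lattice_dk_polytope_convex_hull:
  assumes "finite V" "V \<noteq> {}" "V \<subseteq> integer_points d" "V \<subseteq> hypercube d k"
  shows "lattice_dk_polytope d k (convex hull V)"
proof -
  have "convex hull V \<subseteq> hypercube d k"
    using assms(4) by (intro hull_minimal convex_hypercube)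
  moreover have "hypercube d k \<subseteq> coord_space d"
    by (auto simp: hypercube_def)
  moreover have "{v. v extreme_point_of convex hull V} \<subseteq> integer_points d"
    using assms(3) extreme_point_of_convex_hull by blast
  ultimately show ?thesis
    using assms(1,2) unfolding lattice_dk_polytope_def lattice_polytope_def polytope_def
    by auto
qed

lemma zero_one_vertices:
  assumes "\<And>j. Poly_Mapping.lookup x j \<in> {0, 1}" "\<And>j. j \<ge> d \<Longrightarrow> Poly_Mapping.lookup x j = 0" "k > 0"
  shows "x \<in> integer_points d" "x \<in> hypercube d k"
proof -
  have "Poly_Mapping.lookup x j \<in> \<int> \<and> Poly_Mapping.lookup x j \<in> {0..real k}" for j
    using assms(1)[of j] assms(3) by auto
  then show "x \<in> integer_points d" "x \<in> hypercube d k"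
    using assms(2) by (auto simp: integer_points_def hypercube_def coord_space_def)
qed

text \<open>Each equation is linear and holds at every vertex, so its solution set is convex and
  contains the hull. Coordinates \<open>i\<close> and \<open>n + i\<close> both read off the
  coefficient of \<open>P_vertex n i\<close>.\<close>

lemma P_hull_equations:
  assumes "x \<in> convex hull (P_vertex n ` {..<n})"
  shows "\<And>i. i < n \<Longrightarrow> Poly_Mapping.lookup x (n + i) = Poly_Mapping.lookup x i"
    and "(\<Sum>i<n. Poly_Mapping.lookup x i) = 1"
proof -
  have "convex hull (P_vertex n ` {..<n}) \<subseteq>
      {x. Poly_Mapping.lookup x (n + i) - Poly_Mapping.lookup x i = 0}" if "i < n" for i
    using that by (intro hull_minimal convex_linear_eq linear_compose_sub linear_lookup)
      (auto simp: lookup_P_vertex)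
  then show "\<And>i. i < n \<Longrightarrow> Poly_Mapping.lookup x (n + i) = Poly_Mapping.lookup x i"
    using assms by fastforce
  have "convex hull (P_vertex n ` {..<n}) \<subseteq> {x. (\<Sum>i<n. Poly_Mapping.lookup x i) = 1}"
    by (intro hull_minimal convex_linear_eq linear_compose_sum ballI linear_lookup)
      (auto simp: lookup_P_vertex of_bool_def)
  then show "(\<Sum>i<n. Poly_Mapping.lookup x i) = 1"
    using assms by auto
qed

text \<open>Coordinate \<open>n + i\<close> reads off the coefficient of
  \<open>Q_vertex n i\<close>, and coordinate \<open>j\<close> collects those with
  \<open>i < j\<close>. For \<open>j = 0\<close> the empty sum gives 0.\<close>

lemma Q_hull_equations:
  assumes "x \<in> convex hull (Q_vertex n ` {..<n})" "j < n"
  shows "Poly_Mapping.lookup x j = (\<Sum>i<j. Poly_Mapping.lookup x (n + i))"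
proof -
  have "convex hull (Q_vertex n ` {..<n}) \<subseteq>
      {x. Poly_Mapping.lookup x j - (\<Sum>i<j. Poly_Mapping.lookup x (n + i)) = 0}"
    using assms(2)
    by (intro hull_minimal convex_linear_eq linear_compose_sub linear_compose_sum ballI linear_lookup)
      (auto simp: lookup_Q_vertex of_bool_def)
  then show ?thesis
    using assms(1) by auto
qed

lemma P_Q_hulls_disjoint:
  "convex hull (P_vertex n ` {..<n}) \<inter> convex hull (Q_vertex n ` {..<n}) = {}"
proof -
  have False if x: "x \<in> convex hull (P_vertex n ` {..<n})" "x \<in> convex hull (Q_vertex n ` {..<n})"
    for x
  proof -
    \<comment> \<open>In a common point, coordinate \<open>j\<close> is the sum of the earlier
      coordinates, so all of the first \<open>n\<close> vanish although they sum to 1.\<close>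
    have "j < n \<Longrightarrow> Poly_Mapping.lookup x j = 0" for j
    proof (induction j rule: less_induct)
      case (less j)
      then show ?case
        using Q_hull_equations[OF x(2), of j] P_hull_equations(1)[OF x(1)] by simp
    qed
    then show False
      using P_hull_equations(2)[OF x(1)] by simp
  qed
  then show ?thesis by auto
qed

lemma euclid_setdist_le:
  assumes "x \<in> P" "y \<in> Q"
  shows "euclid_setdist d P Q \<le> euclid_dist d x y"
  unfolding euclid_setdist_def using assms
  by (intro cInf_lower bdd_belowI[of _ 0]) (auto simp: euclid_dist_def L2_set_nonneg)

text \<open>The sequence 1, 1, 2, 4, ..., in which each term after the first is the sum of all
  earlier ones.\<close>

definition weight :: "nat \<Rightarrow> real" where
  "weight i = (if i = 0 then 1 else 2 ^ (i - 1))"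

lemma sum_weight: "(\<Sum>i<Suc m. weight i) = 2 ^ m"
  by (induction m) (simp_all add: weight_def)

lemma P_Q_hulls_close:
  assumes "2 * Suc m \<le> d"
  shows "euclid_setdist d (convex hull (P_vertex (Suc m) ` {..<Suc m}))
           (convex hull (Q_vertex (Suc m) ` {..<Suc m})) \<le> 1 / 2 ^ m"
proof -
  define n where "n = Suc m"
  define c where "c i = weight i / 2 ^ m" for i
  define x where "x = (\<Sum>i<n. c i *\<^sub>R P_vertex n i)"
  define y where "y = (\<Sum>i<n. c i *\<^sub>R Q_vertex n i)"
  have c_sum: "(\<Sum>i<n. c i) = 1"
    using sum_weight[of m] by (simp add: c_def n_def flip: sum_divide_distrib del: sum.lessThan_Suc)
  have c_nonneg: "0 \<le> c i" for i
    by (simp add: c_def weight_def)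
  \<comment> \<open>At \<open>j = 0\<close> this fails by \<open>c 0 = 1 / 2 ^ m\<close>, the only
    discrepancy between \<open>x\<close> and \<open>y\<close>.\<close>
  have c_rec: "(\<Sum>i<j. c i) = c j" if "0 < j" for j
    using sum_weight[of "j - 1"] that
    by (simp add: c_def weight_def[of j] flip: sum_divide_distrib del: sum.lessThan_Suc)
  have x: "x \<in> convex hull (P_vertex n ` {..<n})"
    unfolding x_def using c_sum c_nonneg by (intro convex_sum) (auto intro: hull_inc)
  have y: "y \<in> convex hull (Q_vertex n ` {..<n})"
    unfolding y_def using c_sum c_nonneg by (intro convex_sum) (auto intro: hull_inc)
  have lookup_x: "Poly_Mapping.lookup x j = (\<Sum>i<n. if j = i \<or> j = n + i then c i else 0)" for j
    unfolding x_def by (auto simp: lookup_sum lookup_scaleR lookup_P_vertex of_bool_def intro!: sum.cong)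
  have lookup_y: "Poly_Mapping.lookup y j = (\<Sum>i<n. if j = n + i \<or> i < j \<and> j < n then c i else 0)" for j
    unfolding y_def by (auto simp: lookup_sum lookup_scaleR lookup_Q_vertex of_bool_def intro!: sum.cong)
  have diff: "Poly_Mapping.lookup x j - Poly_Mapping.lookup y j = (if j = 0 then 1 / 2 ^ m else 0)" for j
  proof (cases "j < n")
    case True
    have "Poly_Mapping.lookup x j = (\<Sum>i<n. if j = i then c i else 0)"
      unfolding lookup_x using True by (intro sum.cong) auto
    also have "\<dots> = c j"
      using True by simp
    finally have xj: "Poly_Mapping.lookup x j = c j" .
    have "Poly_Mapping.lookup y j = (\<Sum>i<n. if i < j then c i else 0)"
      unfolding lookup_y using True by (intro sum.cong) auto
    also have "\<dots> = (\<Sum>i<j. c i)"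
      using True by (intro sum.mono_neutral_cong_right) auto
    finally show ?thesis
      using xj c_rec[of j] by (cases "j = 0") (auto simp: c_def weight_def)
  \<comment> \<open>From index \<open>n\<close> on, the vertices \<open>P_vertex n i\<close> and
    \<open>Q_vertex n i\<close> agree, and \<open>x\<close> and \<open>y\<close> have the same
    coefficients.\<close>
  next
    case False
    have "Poly_Mapping.lookup x j = Poly_Mapping.lookup y j"
      unfolding lookup_x lookup_y using False by (intro sum.cong) auto
    then show ?thesis
      using False by (simp add: n_def)
  qed
  have "euclid_dist d x y = 1 / 2 ^ m"
    using assms by (simp add: euclid_dist_def L2_set_def diff if_distrib[of "\<lambda>t. t ^ 2"]
        cong: if_cong)
  then show ?thesis
    using euclid_setdist_le[OF x y, of d] by (simp add: n_def)
qed

text \<open>The logarithm of the left side is of order \<open>sqrt d * ln d\<close>, that of the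
  right side is linear in \<open>d\<close>.\<close>

lemma eventually_powr_sqrt_le:
  fixes k :: real
  assumes "k > 0"
  shows "\<forall>\<^sub>F d :: nat in sequentially. (k * sqrt d) powr sqrt d \<le> 2 powr (d / 2 - 3 / 2)"
  using assms by real_asymp

theorem theorem1p2:
  fixes k :: nat
  assumes "k > 0"
  shows "\<exists>d0 :: nat. \<forall>d\<ge>d0. \<exists>P Q.
           lattice_dk_polytope d k P \<and> lattice_dk_polytope d k Q \<and> P \<inter> Q = {} \<and>
           euclid_setdist d P Q \<le> 1 / (real k * sqrt (real d)) powr sqrt (real d)"
proof -
  obtain d1 where d1: "(real k * sqrt d) powr sqrt d \<le> 2 powr (d / 2 - 3 / 2)" if "d \<ge> d1" for d :: nat
    using eventually_powr_sqrt_le[of "real k"] assms by (auto simp: eventually_sequentially)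
  have "\<exists>P Q. lattice_dk_polytope d k P \<and> lattice_dk_polytope d k Q \<and> P \<inter> Q = {} \<and>
      euclid_setdist d P Q \<le> 1 / (real k * sqrt (real d)) powr sqrt (real d)"
    if d: "d \<ge> max d1 2" for d
  proof -
    \<comment> \<open>\<open>Suc m\<close> is \<open>d div 2\<close>, as \<open>d \<ge> 2\<close>
      makes the subtraction exact. Rounding leaves \<open>m \<ge> (d - 3) / 2\<close>, whence the
      exponent \<open>d / 2 - 3 / 2\<close>.\<close>
    define m where "m = d div 2 - 1"
    define P where "P = convex hull (P_vertex (Suc m) ` {..<Suc m})"
    define Q where "Q = convex hull (Q_vertex (Suc m) ` {..<Suc m})"
    have m: "2 * Suc m \<le> d" "d \<le> 2 * m + 3"
      using d by (auto simp: m_def)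
    have "lattice_dk_polytope d k P" "lattice_dk_polytope d k Q"
      unfolding P_def Q_def using m(1) assms
      by (auto intro!: lattice_dk_polytope_convex_hull zero_one_vertices
          simp: lookup_P_vertex lookup_Q_vertex)
    moreover have "P \<inter> Q = {}"
      unfolding P_def Q_def by (rule P_Q_hulls_disjoint)
    moreover have "euclid_setdist d P Q \<le> 1 / (real k * sqrt d) powr sqrt d"
    proof -
      have "(real k * sqrt d) powr sqrt d \<le> 2 powr (d / 2 - 3 / 2)"
        using d1 d by simp
      also have "\<dots> \<le> 2 powr real m"
        using m(2) by (intro powr_mono) auto
      also have "\<dots> = 2 ^ m"
        by (simp add: powr_realpow)
      finally have "1 / 2 ^ m \<le> 1 / (real k * sqrt d) powr sqrt d"
        using assms d by (intro divide_left_mono) auto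
      then show ?thesis
        using P_Q_hulls_close[OF m(1)] unfolding P_def Q_def by linarith
    qed
    ultimately show ?thesis by blast
  qed
  then show ?thesis by blast
qed

end
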